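(* Let $F$ be a field of characteristic zero, $(A,+)$ a non-trivial abelian group, $g:A\to F$ an additive map and $f:A\times A\to F$ an anti-symmetric biadditive non-degenerate map. Assume that either $g=0$, or $g\ne 0$ and $h:A\to F$ is an additive map such that $f(a,b)=g(a)h(b)-g(b)h(a)$ for all $a,b\in A$. Let $L=L(A,g,f)$ be the corresponding Block Lie algebra. (1) If $g=0$, then there is only one non-trivial transposed Poisson algebra structure $\cdot$ on $L(A,0,f)$. It is given by $u_0\cdot u_0=u_0$ (all other products of basis elements $u_a\cdot u_b$ being zero). (2) If $g\ne 0$ and $(g(a),h(a))\ne(0,-1)$ for all $a\in A$, then all the transposed Poisson algebra structures on $L(A,g,f)$ are trivial. (3) If $g\neq 0$ and there is $a\in A$ such that $(g(a),h(a))=(0,-1)$, then the transposed Poisson algebra structures on $L(A,g,f)$ are usual Poisson algebra structures that are extensions by zero of commutative associative products $*$ on the complement $V=\mathrm{span}_F\{u_a\mid g(a)=h(a)+2=0\}$ of $[L,L]$ with values in $Z(L)=\mathrm{span}_F\{u_a\mid g(a)=h(a)+1=0\}$.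
   Context: All algebras are over $F$ and all linear maps are $F$-linear. Additive maps are homomorphisms of additive groups. Block Lie algebra: $L(A,g,f)$ is the $F$-vector space with basis $\{u_a\}_{a\in A}$ and bilinear product $[u_a,u_b]=(f(a,b)+g(a-b))u_{a+b}$; under the stated assumption ($g=0$ or $h$ exists) it is a Lie algebra. Non-degenerate means: for $a\in A$, $f(a,b)=0$ for all $b\in A$ if and only if $a=0$. A transposed Poisson algebra structure on a Lie algebra $(\mathfrak L,[\cdot,\cdot])$ is a commutative associative bilinear multiplication $\cdot$ on $\mathfrak L$ such that $2z\cdot[x,y]=[z\cdot x,y]+[x,z\cdot y]$ for all $x,y,z\in\mathfrak L$. It is trivial if $x\cdot y=0$ for all $x,y$. A (usual) Poisson algebra structure on $\mathfrak L$ is a commutative associative bilinear multiplication $\cdot$ with $[x,y\cdot z]=[x,y]\cdot z+y\cdot[x,z]$ for all $x,y,z$. $Z(\mathfrak L)$ is the center of $\mathfrak L$ and $[\mathfrak L,\mathfrak L]$ is the span of all brackets. If $V$ is a vector space complement of $[\mathfrak L,\mathfrak L]$ in $\mathfrak L$ and $*:V\times V\to Z(\mathfrak L)$ is a bilinear commutative product, the extension by zero of $*$ is the product on $\mathfrak L$ given by $(a_1+a_2)\cdot(b_1+b_2)=a_1*b_1$ for $a_1,b_1\in V$, $a_2,b_2\in[\mathfrak L,\mathfrak L]$; $*$ is called associative if this extension by zero is associative.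
   Formalization: In (1), "only one" is literally false, since u_0·u_0 = c u_0 works for every nonzero c in F; it is proved instead that every non-trivial structure is a nonzero scalar multiple of the displayed one and is isomorphic to it. *)

theory Defs
  imports Complex_Main "HOL-Library.Poly_Mapping"
begin

section \<open>Algebras over a field\<close>

text \<open>
  Products are plain binary functions on an additive group that carries a vector space
  structure \<open>scale\<close>; being bilinear includes the fact that \<open>scale\<close> is a vector space.
\<close>

definition bilinear_product :: "('f::field \<Rightarrow> 'v::ab_group_add \<Rightarrow> 'v) \<Rightarrow> ('v \<Rightarrow> 'v \<Rightarrow> 'v) \<Rightarrow> bool"
  where "bilinear_product scale m \<longleftrightarrow>
    (\<forall>x. Vector_Spaces.linear scale scale (m x)) \<and>
    (\<forall>y. Vector_Spaces.linear scale scale (\<lambda>x. m x y))"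

definition lie_algebra :: "('f::field \<Rightarrow> 'v::ab_group_add \<Rightarrow> 'v) \<Rightarrow> ('v \<Rightarrow> 'v \<Rightarrow> 'v) \<Rightarrow> bool"
  where "lie_algebra scale br \<longleftrightarrow>
    bilinear_product scale br \<and> (\<forall>x. br x x = 0) \<and>
    (\<forall>x y z. br x (br y z) + br y (br z x) + br z (br x y) = 0)"

definition comm_assoc_product :: "('f::field \<Rightarrow> 'v::ab_group_add \<Rightarrow> 'v) \<Rightarrow> ('v \<Rightarrow> 'v \<Rightarrow> 'v) \<Rightarrow> bool"
  where "comm_assoc_product scale m \<longleftrightarrow>
    bilinear_product scale m \<and> (\<forall>x y. m x y = m y x) \<and> (\<forall>x y z. m (m x y) z = m x (m y z))"

definition transposed_poisson ::
    "('f::field \<Rightarrow> 'v::ab_group_add \<Rightarrow> 'v) \<Rightarrow> ('v \<Rightarrow> 'v \<Rightarrow> 'v) \<Rightarrow> ('v \<Rightarrow> 'v \<Rightarrow> 'v) \<Rightarrow> bool"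
  where "transposed_poisson scale br m \<longleftrightarrow> comm_assoc_product scale m \<and>
    (\<forall>x y z. scale 2 (m z (br x y)) = br (m z x) y + br x (m z y))"

definition poisson ::
    "('f::field \<Rightarrow> 'v::ab_group_add \<Rightarrow> 'v) \<Rightarrow> ('v \<Rightarrow> 'v \<Rightarrow> 'v) \<Rightarrow> ('v \<Rightarrow> 'v \<Rightarrow> 'v) \<Rightarrow> bool"
  where "poisson scale br m \<longleftrightarrow> comm_assoc_product scale m \<and>
    (\<forall>x y z. br x (m y z) = m (br x y) z + m y (br x z))"

definition trivial_product :: "('v::zero \<Rightarrow> 'v \<Rightarrow> 'v) \<Rightarrow> bool"
  where "trivial_product m \<longleftrightarrow> (\<forall>x y. m x y = 0)"

text \<open>
  Uniqueness of a structure can only be meant up to isomorphism: if \<open>m\<close> is a transposed Poisson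
  structure, then so is every scalar multiple of \<open>m\<close>.
  Isomorphism of \<open>(L, br, m)\<close> and \<open>(L, br, m')\<close>: both products are preserved.
\<close>

definition isomorphic_structures ::
    "('f::field \<Rightarrow> 'v::ab_group_add \<Rightarrow> 'v) \<Rightarrow> ('v \<Rightarrow> 'v \<Rightarrow> 'v) \<Rightarrow> ('v \<Rightarrow> 'v \<Rightarrow> 'v) \<Rightarrow> ('v \<Rightarrow> 'v \<Rightarrow> 'v) \<Rightarrow> bool"
  where "isomorphic_structures scale br m m' \<longleftrightarrow>
    (\<exists>\<phi>. Vector_Spaces.linear scale scale \<phi> \<and> bij \<phi> \<and>
      (\<forall>x y. \<phi> (br x y) = br (\<phi> x) (\<phi> y)) \<and> (\<forall>x y. \<phi> (m x y) = m' (\<phi> x) (\<phi> y)))"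

definition lie_center :: "('v::ab_group_add \<Rightarrow> 'v \<Rightarrow> 'v) \<Rightarrow> 'v set"
  where "lie_center br = {z. \<forall>x. br z x = 0}"

definition lie_derived :: "('f::field \<Rightarrow> 'v::ab_group_add \<Rightarrow> 'v) \<Rightarrow> ('v \<Rightarrow> 'v \<Rightarrow> 'v) \<Rightarrow> 'v set"
  where "lie_derived scale br = module.span scale {br x y |x y. True}"

definition is_complement :: "('f::field \<Rightarrow> 'v::ab_group_add \<Rightarrow> 'v) \<Rightarrow> 'v set \<Rightarrow> 'v set \<Rightarrow> bool"
  where "is_complement scale V D \<longleftrightarrow> module.subspace scale V \<and> module.subspace scale D \<and>
    V \<inter> D = {0} \<and> (\<forall>x. \<exists>v\<in>V. \<exists>d\<in>D. x = v + d)"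

text \<open>
  \<open>extension_by_zero V D s\<close> is the product \<open>(a\<^sub>1 + a\<^sub>2) \<cdot> (b\<^sub>1 + b\<^sub>2) = s a\<^sub>1 b\<^sub>1\<close>
  for \<open>a\<^sub>1, b\<^sub>1 \<in> V\<close> and \<open>a\<^sub>2, b\<^sub>2 \<in> D\<close>; it is meaningful when \<open>V\<close> is a complement of \<open>D\<close>,
  in which case the component \<open>component V D x\<close> is unique.
\<close>

definition component :: "'v::ab_group_add set \<Rightarrow> 'v set \<Rightarrow> 'v \<Rightarrow> 'v"
  where "component V D x = (THE v. v \<in> V \<and> (\<exists>d\<in>D. x = v + d))"

definition extension_by_zero ::
    "'v::ab_group_add set \<Rightarrow> 'v set \<Rightarrow> ('v \<Rightarrow> 'v \<Rightarrow> 'v) \<Rightarrow> 'v \<Rightarrow> 'v \<Rightarrow> 'v"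
  where "extension_by_zero V D s x y = s (component V D x) (component V D y)"

text \<open>
  Bilinear commutative products \<open>V \<times> V \<rightarrow> Z\<close>, given by functions of which only the values
  on \<open>V \<times> V\<close> matter; linearity in the second argument follows by commutativity.
  Associativity refers to the extension by zero, since values of \<open>s\<close> need not lie in \<open>V\<close>.
\<close>

definition comm_product_into ::
    "('f::field \<Rightarrow> 'v::ab_group_add \<Rightarrow> 'v) \<Rightarrow> 'v set \<Rightarrow> 'v set \<Rightarrow> ('v \<Rightarrow> 'v \<Rightarrow> 'v) \<Rightarrow> bool"
  where "comm_product_into scale V Z s \<longleftrightarrow>
    (\<forall>x\<in>V. \<forall>y\<in>V. s x y \<in> Z) \<and>
    (\<forall>x\<in>V. \<forall>y\<in>V. s x y = s y x) \<and>
    (\<forall>x\<in>V. \<forall>x'\<in>V. \<forall>y\<in>V. s (x + x') y = s x y + s x' y) \<and>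
    (\<forall>c. \<forall>x\<in>V. \<forall>y\<in>V. s (scale c x) y = scale c (s x y))"

definition associative_by_zero :: "'v::ab_group_add set \<Rightarrow> 'v set \<Rightarrow> ('v \<Rightarrow> 'v \<Rightarrow> 'v) \<Rightarrow> bool"
  where "associative_by_zero V D s \<longleftrightarrow>
    (let m = extension_by_zero V D s in \<forall>x y z. m (m x y) z = m x (m y z))"


section \<open>Block Lie algebras\<close>

text \<open>
  The vector space with basis \<open>A\<close> is the type of finitely supported functions from \<open>A\<close> to \<open>F\<close>.
\<close>

definition fscale :: "'f::field \<Rightarrow> ('a \<Rightarrow>\<^sub>0 'f) \<Rightarrow> ('a \<Rightarrow>\<^sub>0 'f)"
  where "fscale c x = Poly_Mapping.map ((*) c) x"

definition u :: "'a \<Rightarrow> ('a \<Rightarrow>\<^sub>0 'f::field)"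
  where "u a = Poly_Mapping.single a 1"

definition block_bracket ::
    "('a::ab_group_add \<Rightarrow> 'f::field) \<Rightarrow> ('a \<Rightarrow> 'a \<Rightarrow> 'f) \<Rightarrow> ('a \<Rightarrow>\<^sub>0 'f) \<Rightarrow> ('a \<Rightarrow>\<^sub>0 'f) \<Rightarrow> ('a \<Rightarrow>\<^sub>0 'f)"
  where "block_bracket g f x y =
    (\<Sum>a\<in>Poly_Mapping.keys x. \<Sum>b\<in>Poly_Mapping.keys y.
      fscale (Poly_Mapping.lookup x a * Poly_Mapping.lookup y b) (fscale (f a b + g (a - b)) (u (a + b))))"

definition biadditive :: "('a::ab_group_add \<Rightarrow> 'a \<Rightarrow> 'f::ab_group_add) \<Rightarrow> bool"
  where "biadditive f \<longleftrightarrow> (\<forall>a. additive (f a)) \<and> (\<forall>b. additive (\<lambda>a. f a b))"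

definition non_degenerate :: "('a::ab_group_add \<Rightarrow> 'a \<Rightarrow> 'f::zero) \<Rightarrow> bool"
  where "non_degenerate f \<longleftrightarrow> (\<forall>a. (\<forall>b. f a b = 0) \<longleftrightarrow> a = 0)"


subsection \<open>Basic facts\<close>

lemma lookup_fscale [simp]: "Poly_Mapping.lookup (fscale c x) a = c * Poly_Mapping.lookup x a"
  by (simp add: fscale_def Poly_Mapping.map.rep_eq when_def)

lemma vector_space_fscale: "vector_space (fscale :: 'f::field \<Rightarrow> ('a \<Rightarrow>\<^sub>0 'f) \<Rightarrow> _)"
  by standard (auto intro!: poly_mapping_eqI simp: lookup_add algebra_simps)

lemma block_bracket_basis: "block_bracket g f (u a) (u b) = fscale (f a b + g (a - b)) (u (a + b))"
  by (simp add: block_bracket_def u_def) (rule poly_mapping_eqI, simp)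

lemma block_induct [case_names basis sum]:
  fixes x :: "'a \<Rightarrow>\<^sub>0 'f::field"
  assumes basis: "\<And>k v. P (fscale v (u k))"
    and sum: "\<And>x y. P x \<Longrightarrow> P y \<Longrightarrow> P (x + y)"
  shows "P x"
proof (induction x rule: update_induct)
  case const
  have "fscale 0 (u undefined) = (0 :: 'a \<Rightarrow>\<^sub>0 'f)"
    by (rule poly_mapping_eqI) simp
  then show ?case using basis by metis
next
  case (update x k v)
  have "Poly_Mapping.update k v x = x + fscale v (u k)"
    using update(1)
    by (intro poly_mapping_eqI)
       (auto simp: lookup_update lookup_add u_def lookup_single when_def in_keys_iff)
  with update sum basis show ?case by simp
qed

lemma u_span: "module.span fscale (range u) = (UNIV :: ('a \<Rightarrow>\<^sub>0 'f::field) set)"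
proof -
  interpret V: vector_space "fscale :: 'f \<Rightarrow> ('a \<Rightarrow>\<^sub>0 'f) \<Rightarrow> _" by (rule vector_space_fscale)
  have "x \<in> V.span (range u)" for x :: "'a \<Rightarrow>\<^sub>0 'f"
    by (induction x rule: block_induct) (auto intro: V.span_base V.span_scale V.span_add)
  then show ?thesis by auto
qed

lemma block_bracket_superset:
  fixes g :: "'a::ab_group_add \<Rightarrow> 'b::field"
  assumes "finite S" "finite T" "Poly_Mapping.keys x \<subseteq> S" "Poly_Mapping.keys y \<subseteq> T"
  shows "block_bracket g f x y = (\<Sum>a\<in>S. \<Sum>b\<in>T.
      fscale (Poly_Mapping.lookup x a * Poly_Mapping.lookup y b) (fscale (f a b + g (a - b)) (u (a + b))))"
proof -
  interpret V: vector_space "fscale :: 'b \<Rightarrow> ('a \<Rightarrow>\<^sub>0 'b) \<Rightarrow> _" by (rule vector_space_fscale)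
  have "(\<Sum>b\<in>Poly_Mapping.keys y. fscale (Poly_Mapping.lookup x a * Poly_Mapping.lookup y b)
          (fscale (f a b + g (a - b)) (u (a + b)))) =
        (\<Sum>b\<in>T. fscale (Poly_Mapping.lookup x a * Poly_Mapping.lookup y b)
          (fscale (f a b + g (a - b)) (u (a + b))))" for a
    using assms by (intro sum.mono_neutral_left) (auto simp: in_keys_iff)
  moreover have "(\<Sum>a\<in>Poly_Mapping.keys x. \<Sum>b\<in>T. fscale (Poly_Mapping.lookup x a * Poly_Mapping.lookup y b)
          (fscale (f a b + g (a - b)) (u (a + b)))) =
        (\<Sum>a\<in>S. \<Sum>b\<in>T. fscale (Poly_Mapping.lookup x a * Poly_Mapping.lookup y b)
          (fscale (f a b + g (a - b)) (u (a + b))))"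
    using assms by (intro sum.mono_neutral_left) (auto simp: in_keys_iff)
  ultimately show ?thesis by (simp add: block_bracket_def)
qed

lemma keys_fscale: "Poly_Mapping.keys (fscale c x) \<subseteq> Poly_Mapping.keys x"
  by (auto simp: in_keys_iff)

lemma bilinear_block_bracket:
  fixes g :: "'a::ab_group_add \<Rightarrow> 'b::field"
  shows "bilinear_product fscale (block_bracket g f)"
proof -
  interpret V: vector_space "fscale :: 'b \<Rightarrow> ('a \<Rightarrow>\<^sub>0 'b) \<Rightarrow> _" by (rule vector_space_fscale)
  let ?B = "block_bracket g f"
  have ka: "Poly_Mapping.keys (y + z) \<subseteq> Poly_Mapping.keys y \<union> Poly_Mapping.keys z"
    for y z :: "'a \<Rightarrow>\<^sub>0 'b" by (rule keys_add)
  have r: "?B x (y + z) = ?B x y + ?B x z" for x y z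
  proof -
    let ?T = "Poly_Mapping.keys y \<union> Poly_Mapping.keys z"
    have "?B x w = (\<Sum>a\<in>Poly_Mapping.keys x. \<Sum>b\<in>?T. fscale (Poly_Mapping.lookup x a * Poly_Mapping.lookup w b)
          (fscale (f a b + g (a - b)) (u (a + b))))" if "Poly_Mapping.keys w \<subseteq> ?T" for w
      using that by (intro block_bracket_superset) auto
    then show ?thesis
      by (simp add: ka lookup_add distrib_left V.scale_left_distrib sum.distrib)
  qed
  have l: "?B (y + z) x = ?B y x + ?B z x" for x y z
  proof -
    let ?T = "Poly_Mapping.keys y \<union> Poly_Mapping.keys z"
    have "?B w x = (\<Sum>a\<in>?T. \<Sum>b\<in>Poly_Mapping.keys x. fscale (Poly_Mapping.lookup w a * Poly_Mapping.lookup x b)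
          (fscale (f a b + g (a - b)) (u (a + b))))" if "Poly_Mapping.keys w \<subseteq> ?T" for w
      using that by (intro block_bracket_superset) auto
    then show ?thesis
      by (simp add: ka lookup_add distrib_right V.scale_left_distrib sum.distrib)
  qed
  have sr: "?B x (fscale c y) = fscale c (?B x y)" for x y c
    by (subst block_bracket_superset[OF finite_keys finite_keys subset_refl keys_fscale])
       (simp add: block_bracket_def V.scale_sum_right mult.left_commute mult.assoc)
  have sl: "?B (fscale c x) y = fscale c (?B x y)" for x y c
    by (subst block_bracket_superset[OF finite_keys finite_keys keys_fscale subset_refl])
       (simp add: block_bracket_def V.scale_sum_right mult.left_commute mult.assoc)
  show ?thesis unfolding bilinear_product_def
    by (intro conjI allI; unfold_locales) (simp_all add: r l sr sl)
qed

lemma block_lie_algebra: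
  fixes g :: "'a::ab_group_add \<Rightarrow> 'f::field_char_0"
  assumes "additive g" "biadditive f" "\<And>a b. f a b = - f b a"
    and gh: "g = (\<lambda>_. 0) \<or> (additive h \<and> (\<forall>a b. f a b = g a * h b - g b * h a))"
  shows "lie_algebra fscale (block_bracket g f)"
proof -
  interpret V: vector_space "fscale :: 'f \<Rightarrow> ('a \<Rightarrow>\<^sub>0 'f) \<Rightarrow> _" by (rule vector_space_fscale)
  interpret g: additive g by fact
  let ?B = "block_bracket g f"
  have fl: "f (a + b) c = f a c + f b c" and fr: "f c (a + b) = f c a + f c b" for a b c
    using assms(2) by (auto simp: biadditive_def additive_def)
  have ff: "f a a = 0" for a using assms(3)[of a a] by simp
  have lr: "Vector_Spaces.linear fscale fscale (?B x)" and ll: "Vector_Spaces.linear fscale fscale (\<lambda>x. ?B x y)"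
    for x y using bilinear_block_bracket[of g f] by (auto simp: bilinear_product_def)
  note lin = Vector_Spaces.linear_iff
  have add: "?B x (y + z) = ?B x y + ?B x z" "?B (y + z) x = ?B y x + ?B z x" for x y z
    using lr ll by (auto simp: lin)
  have sc: "?B x (fscale c y) = fscale c (?B x y)" "?B (fscale c x) y = fscale c (?B x y)" for x y c
    using lr ll by (auto simp: lin)
  have anti: "?B x y = - ?B y x" for x y
  proof (induction x rule: block_induct)
    case (basis k v)
    show ?case
    proof (induction y rule: block_induct)
      case (basis l w)
      have "f k l + g (k - l) = - (f l k + g (l - k))"
        using assms(3)[of k l] by (simp add: g.diff)
      then have "?B (u k) (u l) = - ?B (u l) (u k)"
        by (simp add: block_bracket_basis add.commute[of l k] flip: V.scale_minus_left)
      then show ?case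
        by (simp add: sc mult.commute)
    qed (simp add: add)
  qed (simp add: add)
  have alt: "?B x x = 0" for x
  proof (rule poly_mapping_eqI)
    fix k
    have "Poly_Mapping.lookup (?B x x) k = - Poly_Mapping.lookup (?B x x) k"
      using anti[of x x] by (metis lookup_uminus)
    then show "Poly_Mapping.lookup (?B x x) k = Poly_Mapping.lookup 0 k" by simp
  qed
  have jac0: "?B (u a) (?B (u b) (u c)) + ?B (u b) (?B (u c) (u a)) + ?B (u c) (?B (u a) (u b)) = 0" for a b c
  proof -
    have e: "b + c + a = a + b + c" "c + a + b = a + b + c" "b + (c + a) = a + b + c" "c + (a + b) = a + b + c"
      "a + (b + c) = a + b + c"
      by (simp_all add: ac_simps)
    have "(f b c + g (b - c)) * (f a (b + c) + g (a - (b + c)))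
        + (f c a + g (c - a)) * (f b (c + a) + g (b - (c + a)))
        + (f a b + g (a - b)) * (f c (a + b) + g (c - (a + b))) = 0"
      using gh
    proof
      assume "g = (\<lambda>_. 0)"
      moreover have "f b a = - f a b" "f c a = - f a c" "f c b = - f b c"
        by (rule assms(3))+
      ultimately show ?thesis by (simp add: fl fr algebra_simps)
    next
      assume "additive h \<and> (\<forall>a b. f a b = g a * h b - g b * h a)"
      then have h: "h (x + y) = h x + h y" and fh: "f x y = g x * h y - g y * h x" for x y
        by (auto simp: additive.add)
      show ?thesis
        unfolding fh h g.diff g.add by (simp add: algebra_simps)
    qed
    then show ?thesis
      by (simp add: block_bracket_basis sc e flip: V.scale_left_distrib)
  qed
  let ?J = "\<lambda>x y z. ?B x (?B y z) + ?B y (?B z x) + ?B z (?B x y)"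
  have J: "?J (x + x') y z = ?J x y z + ?J x' y z" "?J x (y + y') z = ?J x y z + ?J x y' z"
    "?J x y (z + z') = ?J x y z + ?J x y z'" for x x' y y' z z'
    by (simp_all only: add ac_simps)
  have "?J x y z = 0" for x y z
  proof (induction x rule: block_induct)
    case (basis k v)
    show ?case
    proof (induction y rule: block_induct)
      case (basis l w)
      show ?case
      proof (induction z rule: block_induct)
        case (basis m t)
        have "fscale (v * w * t) (?J (u k) (u l) (u m)) = 0"
          by (simp only: jac0 V.scale_zero_right)
        then show ?case
          by (simp add: sc V.scale_right_distrib mult_ac)
      qed (simp only: J add_0)
    qed (simp only: J add_0)
  qed (simp only: J add_0)
  then show ?thesis using alt bilinear_block_bracket by (simp add: lie_algebra_def)
qed

end

theory Submission
  imports Defs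
begin

text \<open>
  In a transposed Poisson algebra every multiplication operator \<open>\<phi>\<close> is a half-derivation,
  \<open>2 \<phi>[x, y] = [\<phi> x, y] + [x, \<phi> y]\<close>. For each \<open>d\<close>, the coefficient \<open>\<psi> a\<close> of \<open>\<phi> (u a)\<close> at
  \<open>u (a + d)\<close> satisfies a functional equation in \<open>a\<close> alone. If \<open>g = 0\<close>, it forces \<open>\<psi> = 0\<close>
  for \<open>d \<noteq> 0\<close>, and \<open>\<psi>\<close> to be constant off \<open>0\<close> for \<open>d = 0\<close>. If \<open>g \<noteq> 0\<close>, it forces
  \<open>\<phi> (u b) = \<kappa> u b\<close>, up to a multiple of the central \<open>u z\<close>, \<open>(g z, h z) = (0, -1)\<close>,
  in the case \<open>(g b, h b) = (0, -2)\<close>. Comparing \<open>u a \<cdot> u b\<close> with \<open>u b \<cdot> u a\<close> then removes all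
  the diagonal coefficients except that of \<open>u 0 \<cdot> u 0\<close> when \<open>g = 0\<close>.
\<close>

section \<open>Half-derivations\<close>

definition half_derivation :: "('f::field \<Rightarrow> 'v::ab_group_add \<Rightarrow> 'v) \<Rightarrow> ('v \<Rightarrow> 'v \<Rightarrow> 'v) \<Rightarrow> ('v \<Rightarrow> 'v) \<Rightarrow> bool"
  where "half_derivation scale br \<phi> \<longleftrightarrow> Vector_Spaces.linear scale scale \<phi> \<and>
    (\<forall>x y. scale 2 (\<phi> (br x y)) = br (\<phi> x) y + br x (\<phi> y))"

lemma transposed_poisson_half_derivation:
  "transposed_poisson scale br m \<Longrightarrow> half_derivation scale br (m z)"
  by (auto simp: transposed_poisson_def comm_assoc_product_def bilinear_product_def half_derivation_def)

lemma lookup_u: "Poly_Mapping.lookup (u a) b = (if b = a then 1 else 0)"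
  by (simp add: u_def lookup_single when_def)

lemma u_nonzero: "u a \<noteq> 0"
  by (metis lookup_u lookup_zero zero_neq_one)

lemma fscale_0: "fscale 0 x = 0" "fscale c 0 = 0"
  by (rule poly_mapping_eqI; simp)+

lemma bilinear_product_iff:
  assumes "vector_space scale"
  shows "bilinear_product scale m \<longleftrightarrow>
    (\<forall>x y z. m x (y + z) = m x y + m x z) \<and> (\<forall>x y z. m (x + y) z = m x z + m y z) \<and>
    (\<forall>c x y. m x (scale c y) = scale c (m x y)) \<and> (\<forall>c x y. m (scale c x) y = scale c (m x y))"
  using assms by (auto simp: bilinear_product_def Vector_Spaces.linear_iff)

lemmas bilinear_fscale_iff = bilinear_product_iff[OF vector_space_fscale]

lemma block_bracket_add:
  "block_bracket g f x (y + z) = block_bracket g f x y + block_bracket g f x z"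
  "block_bracket g f (x + y) z = block_bracket g f x z + block_bracket g f y z"
  and block_bracket_fscale:
  "block_bracket g f x (fscale c y) = fscale c (block_bracket g f x y)"
  "block_bracket g f (fscale c x) y = fscale c (block_bracket g f x y)"
  using bilinear_block_bracket[of g f] by (auto simp: bilinear_fscale_iff)

lemma lookup_block_bracket_u_right:
  fixes g :: "'a::ab_group_add \<Rightarrow> 'f::field"
  shows "Poly_Mapping.lookup (block_bracket g f x (u b)) e =
     Poly_Mapping.lookup x (e - b) * (f (e - b) b + g (e - b - b))"
  by (induction x rule: block_induct)
     (auto simp: block_bracket_add block_bracket_fscale block_bracket_basis lookup_add lookup_u algebra_simps)

lemma lookup_block_bracket_u_left:
  fixes g :: "'a::ab_group_add \<Rightarrow> 'f::field"
  shows "Poly_Mapping.lookup (block_bracket g f (u a) x) e =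
     Poly_Mapping.lookup x (e - a) * (f a (e - a) + g (a - (e - a)))"
  by (induction x rule: block_induct)
     (auto simp: block_bracket_add block_bracket_fscale block_bracket_basis lookup_add lookup_u algebra_simps)

text \<open>Both sides of the half-derivation identity for \<open>u a\<close> and \<open>u b\<close>
  are compared at index \<open>a + b + d\<close>. The bracket adds indices, so the shift
  \<open>d\<close> is the same in all terms and each \<open>d\<close> can be treated on its
  own.\<close>

lemma half_derivation_coeff:
  fixes g :: "'a::ab_group_add \<Rightarrow> 'f::field"
  assumes "half_derivation fscale (block_bracket g f) \<phi>"
  defines "P \<equiv> \<lambda>a d. Poly_Mapping.lookup (\<phi> (u a)) (a + d)"
  shows "2 * (f a b + g (a - b)) * P (a + b) d =
    (f (a + d) b + g (a + d - b)) * P a d + (f a (b + d) + g (a - (b + d))) * P b d"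
proof -
  have lin: "\<phi> (fscale c x) = fscale c (\<phi> x)" for c x
    using assms by (simp add: half_derivation_def Vector_Spaces.linear_iff)
  have "fscale 2 (\<phi> (block_bracket g f (u a) (u b))) =
      block_bracket g f (\<phi> (u a)) (u b) + block_bracket g f (u a) (\<phi> (u b))"
    using assms by (auto simp: half_derivation_def)
  from arg_cong[OF this, of "\<lambda>x. Poly_Mapping.lookup x (a + b + d)"] show ?thesis
    by (simp add: block_bracket_basis lin lookup_add lookup_block_bracket_u_right
          lookup_block_bracket_u_left P_def algebra_simps)
qed

lemma bilinear_product_eqI:
  fixes m m' :: "('a \<Rightarrow>\<^sub>0 'f::field) \<Rightarrow> ('a \<Rightarrow>\<^sub>0 'f) \<Rightarrow> ('a \<Rightarrow>\<^sub>0 'f)"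
  assumes "bilinear_product fscale m" "bilinear_product fscale m'"
    and "\<And>a b. m (u a) (u b) = m' (u a) (u b)"
  shows "m x y = m' x y"
proof (induction x rule: block_induct)
  case (basis k v)
  show ?case
    by (induction y rule: block_induct) (use assms in \<open>auto simp: bilinear_fscale_iff\<close>)
qed (use assms in \<open>auto simp: bilinear_fscale_iff\<close>)

section \<open>Spans of basis vectors\<close>

lemma span_u:
  "module.span fscale {u a |a. P a} = {x :: 'a \<Rightarrow>\<^sub>0 'f::field. \<forall>a. Poly_Mapping.lookup x a \<noteq> 0 \<longrightarrow> P a}"
proof -
  interpret V: vector_space "fscale :: 'f \<Rightarrow> ('a \<Rightarrow>\<^sub>0 'f) \<Rightarrow> _" by (rule vector_space_fscale)
  let ?S = "{x :: 'a \<Rightarrow>\<^sub>0 'f. \<forall>a. Poly_Mapping.lookup x a \<noteq> 0 \<longrightarrow> P a}"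
  show ?thesis
  proof (intro equalityI subsetI)
    have "V.subspace ?S"
      by (auto simp: V.subspace_def lookup_add) (metis add.right_neutral)
    moreover have "{u a |a. P a} \<subseteq> ?S" by (auto simp: lookup_u split: if_splits)
    ultimately have "V.span {u a |a. P a} \<subseteq> ?S" by (rule V.span_minimal[rotated])
    then show "x \<in> ?S" if "x \<in> V.span {u a |a. P a}" for x using that by blast
  next
    fix x assume x: "x \<in> ?S"
    have "x = (\<Sum>a\<in>Poly_Mapping.keys x. fscale (Poly_Mapping.lookup x a) (u a))"
      by (rule poly_mapping_eqI) (auto simp: lookup_sum lookup_u in_keys_iff if_distrib sum.delta' cong: if_cong)
    also have "\<dots> \<in> V.span {u a |a. P a}"
      using x by (intro V.span_sum V.span_scale V.span_base) (auto simp: in_keys_iff)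
    finally show "x \<in> V.span {u a |a. P a}" .
  qed
qed

lemma is_complement_span_u:
  "is_complement (fscale :: 'f::field \<Rightarrow> ('a \<Rightarrow>\<^sub>0 'f) \<Rightarrow> _)
     (module.span fscale {u a |a. P a}) (module.span fscale {u a |a. \<not> P a})"
proof -
  interpret V: vector_space "fscale :: 'f \<Rightarrow> ('a \<Rightarrow>\<^sub>0 'f) \<Rightarrow> _" by (rule vector_space_fscale)
  let ?V = "V.span {u a |a. P a}" and ?D = "V.span {u a |a. \<not> P a}"
  have "\<exists>v\<in>?V. \<exists>d\<in>?D. x = v + d" for x
  proof (induction x rule: block_induct)
    case (basis k c)
    show ?case
    proof (cases "P k")
      case True
      then have "fscale c (u k) \<in> ?V" by (intro V.span_scale V.span_base) auto
      then show ?thesis by (intro bexI[of _ "fscale c (u k)"] bexI[of _ 0]) (auto simp: V.span_zero)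
    next
      case False
      then have "fscale c (u k) \<in> ?D" by (intro V.span_scale V.span_base) auto
      then show ?thesis by (intro bexI[of _ "fscale c (u k)"] bexI[of _ 0]) (auto simp: V.span_zero)
    qed
  next
    case (sum x y)
    then obtain v d v' d' where "v \<in> ?V" "d \<in> ?D" "x = v + d" "v' \<in> ?V" "d' \<in> ?D" "y = v' + d'" by blast
    then show ?case
      by (intro bexI[of _ "v + v'"] bexI[of _ "d + d'"]) (simp_all add: V.span_add ac_simps)
  qed
  moreover have "?V \<inter> ?D = {0}"
  proof (intro equalityI subsetI)
    fix x assume "x \<in> ?V \<inter> ?D"
    then have "Poly_Mapping.lookup x a = Poly_Mapping.lookup 0 a" for a by (auto simp: span_u)
    then show "x \<in> {0}" by (simp add: poly_mapping_eqI)
  qed (simp add: V.span_zero)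
  ultimately show ?thesis by (simp add: is_complement_def)
qed

section \<open>Extensions by zero\<close>

context vector_space
begin

lemma component_eq:
  assumes "is_complement scale V D" "v \<in> V" "d \<in> D"
  shows "component V D (v + d) = v"
  unfolding component_def
proof (rule the_equality)
  fix w assume "w \<in> V \<and> (\<exists>d'\<in>D. v + d = w + d')"
  then obtain d' where w: "w \<in> V" "d' \<in> D" "v + d = w + d'" by blast
  have "w - v \<in> V" "d - d' \<in> D"
    using assms w by (auto simp: is_complement_def intro: subspace_diff)
  moreover have "w - v = d - d'" using w(3) by (simp add: algebra_simps)
  ultimately have "w - v \<in> V \<inter> D" by simp
  then have "w - v \<in> {0}" using assms(1) by (simp only: is_complement_def)
  then show "w = v" by simp
qed (use assms in blast)

lemma component_in:
  assumes "is_complement scale V D"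
  shows "component V D x \<in> V" "x - component V D x \<in> D"
proof -
  obtain v d where "v \<in> V" "d \<in> D" "x = v + d" using assms unfolding is_complement_def by meson
  then show "component V D x \<in> V" "x - component V D x \<in> D"
    using component_eq[OF assms] by auto
qed

lemma component_add:
  assumes "is_complement scale V D"
  shows "component V D (x + y) = component V D x + component V D y"
proof -
  note c = component_in[OF assms]
  have "component V D ((component V D x + component V D y) +
      ((x - component V D x) + (y - component V D y))) = component V D x + component V D y"
    using c assms by (intro component_eq) (auto simp: is_complement_def intro: subspace_add)
  then show ?thesis by (simp add: algebra_simps)
qed

lemma component_scale:
  assumes "is_complement scale V D"
  shows "component V D (scale c x) = scale c (component V D x)"
proof -
  have "component V D (scale c (component V D x) + scale c (x - component V D x)) = scale c (component V D x)"
    using component_in[OF assms] assms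
    by (intro component_eq) (auto simp: is_complement_def intro: subspace_scale)
  then show ?thesis by (simp flip: scale_right_distrib)
qed

lemma component_complement:
  assumes "is_complement scale V D" "d \<in> D"
  shows "component V D d = 0"
  using component_eq[OF assms(1) _ assms(2), of 0] assms(1) by (auto simp: is_complement_def subspace_0)

text \<open>Every term of both identities vanishes: a product with a bracket is 0 because brackets
  have component 0 in \<open>V\<close>, and a bracket with a product is 0 because products are
  central.\<close>

lemma extension_by_zero_poisson:
  assumes compl: "is_complement scale V (lie_derived scale br)" and lie: "lie_algebra scale br"
    and s: "comm_product_into scale V (lie_center br) s"
    and assoc: "associative_by_zero V (lie_derived scale br) s"
  defines "m \<equiv> extension_by_zero V (lie_derived scale br) s"
  shows "transposed_poisson scale br m" "poisson scale br m"
proof -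
  let ?c = "component V (lie_derived scale br)"
  note cin = component_in[OF compl]
  have m: "m x y = s (?c x) (?c y)" for x y by (simp add: m_def extension_by_zero_def)
  have s_add: "\<And>x x' y. x \<in> V \<Longrightarrow> x' \<in> V \<Longrightarrow> y \<in> V \<Longrightarrow> s (x + x') y = s x y + s x' y"
    and s_scale: "\<And>c x y. x \<in> V \<Longrightarrow> y \<in> V \<Longrightarrow> s (scale c x) y = scale c (s x y)"
    and s_comm: "\<And>x y. x \<in> V \<Longrightarrow> y \<in> V \<Longrightarrow> s x y = s y x"
    and s_in: "\<And>x y. x \<in> V \<Longrightarrow> y \<in> V \<Longrightarrow> s x y \<in> lie_center br"
    using s by (auto simp: comm_product_into_def)
  have comm: "m x y = m y x" for x y using s_comm cin by (auto simp: m)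
  have add: "m (x + y) z = m x z + m y z" and scl: "m (scale c x) y = scale c (m x y)" for x y z c
    using s_add s_scale cin by (auto simp: m component_add[OF compl] component_scale[OF compl])
  have "bilinear_product scale m"
    unfolding bilinear_product_iff[OF vector_space_axioms] using add scl comm by metis
  then have ca: "comm_assoc_product scale m"
    using comm assoc by (simp add: comm_assoc_product_def associative_by_zero_def m_def Let_def)
  have derived: "m x (br y z) = 0" for x y z
  proof -
    have "br y z \<in> lie_derived scale br" unfolding lie_derived_def by (rule span_base) blast
    then have "?c (br y z) = ?c 0"
      using component_complement[OF compl] compl by (simp add: is_complement_def subspace_0)
    \<comment> \<open>The zero vector is written as \<open>scale 0 x\<close> so that homogeneity of
      \<open>m\<close> applies.\<close>
    then have "m x (br y z) = m x (scale 0 x)" by (simp add: m)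
    also have "\<dots> = scale 0 (m x x)" using scl comm by metis
    finally show ?thesis by simp
  qed
  have br: "br (x + y) z = br x z + br y z" "br x (y + z) = br x y + br x z" "br x x = 0" for x y z
    using lie by (auto simp: lie_algebra_def bilinear_product_iff[OF vector_space_axioms])
  have central: "br (m x y) z = 0" "br z (m x y) = 0" for x y z
  proof -
    show 1: "br (m x y) z = 0" for z using s_in cin by (auto simp: m lie_center_def)
    \<comment> \<open>\<open>lie_center\<close> only concerns brackets with the central element on
      the left; polarizing \<open>br x x = 0\<close> moves it to the right.\<close>
    have "br (z + m x y) (z + m x y) = 0" by (rule br)
    then show "br z (m x y) = 0" by (simp add: br(1,2) br(3)[of z] 1)
  qed
  show "transposed_poisson scale br m" "poisson scale br m"
    using ca derived central comm by (simp_all add: transposed_poisson_def poisson_def)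
qed

text \<open>Splitting both arguments along \<open>V\<close> and \<open>D\<close> leaves only the
  product of the \<open>V\<close>-parts. As only values on \<open>V\<close> matter, \<open>m\<close>
  itself can serve as the product that is extended.\<close>

lemma eq_extension_by_zero:
  assumes compl: "is_complement scale V D"
    and m: "comm_assoc_product scale m" "\<And>x y. m x y \<in> Z" "\<And>x y. y \<in> D \<Longrightarrow> m x y = 0"
  shows "comm_product_into scale V Z m" "associative_by_zero V D m" "m = extension_by_zero V D m"
proof -
  have b: "m (x + y) z = m x z + m y z" "m z (x + y) = m z x + m z y"
      "m (scale c x) y = scale c (m x y)" "m x y = m y x" for x y z c
    using m(1) by (auto simp: comm_assoc_product_def bilinear_product_iff[OF vector_space_axioms])
  have "m x y = m (component V D x) (component V D y)" for x y
  proof -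
    note cin = component_in[OF compl]
    have "m x y = m (component V D x + (x - component V D x)) (component V D y + (y - component V D y))" by simp
    also have "\<dots> = m (component V D x) (component V D y)"
      using m(3)[OF cin(2)] b(4) by (simp only: b(1,2)) simp
    finally show ?thesis .
  qed
  then show ext: "m = extension_by_zero V D m"
    by (intro ext) (simp add: extension_by_zero_def)
  show "comm_product_into scale V Z m"
    using b m(2) by (simp add: comm_product_into_def)
  show "associative_by_zero V D m"
    using m(1) unfolding associative_by_zero_def Let_def comm_assoc_product_def ext[symmetric] by blast
qed

end

section \<open>The case \<open>g = 0\<close>\<close>

locale symplectic_group =
  fixes f :: "'a::ab_group_add \<Rightarrow> 'a \<Rightarrow> 'f::field_char_0"
  assumes biadd: "biadditive f" and anti: "f a b = - f b a" and nondeg: "non_degenerate f"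
begin

lemma f_add: "f (a + b) c = f a c + f b c" "f c (a + b) = f c a + f c b"
  using biadd by (auto simp: biadditive_def additive_def)

lemma f_minus: "f (- a) b = - f a b" "f a (- b) = - f a b"
  using biadd additive.minus by (auto simp: biadditive_def)

lemma f_self: "f a a = 0"
  using anti[of a a] by simp

lemma f_0: "f 0 a = 0" "f a 0 = 0"
  using f_add(1)[of 0 0 a] f_add(2)[of a 0 0] by simp_all

lemma f_diff: "f (a - b) c = f a c - f b c" "f c (a - b) = f c a - f c b"
  using f_add(1)[of a "- b" c] f_add(2)[of c a "- b"] by (simp_all add: f_minus)

lemma ex_f_nonzero: "a \<noteq> 0 \<Longrightarrow> \<exists>b. f a b \<noteq> 0"
  using nondeg by (auto simp: non_degenerate_def)

text \<open>A group is not the union of two proper subgroups.\<close>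

lemma ex_f_nonzero2:
  assumes "a \<noteq> 0" "b \<noteq> 0"
  shows "\<exists>c. f a c \<noteq> 0 \<and> f b c \<noteq> 0"
proof -
  obtain x y where "f a x \<noteq> 0" "f b y \<noteq> 0" using assms ex_f_nonzero by meson
  moreover have "f a (x + y) = f a x + f a y" "f b (x + y) = f b x + f b y" by (rule f_add)+
  ultimately show ?thesis by (metis add.right_neutral add_0)
qed

text \<open>If \<open>a + a = 0\<close>, then \<open>2 * f a b = 0\<close> for all \<open>b\<close>,
  which characteristic zero and non-degeneracy exclude. This supplies a second nonzero index when
  diagonal coefficients are compared.\<close>

lemma double_nonzero: "(a::'a) \<noteq> 0 \<Longrightarrow> a + a \<noteq> 0"
  using ex_f_nonzero[of a] f_add(1)[of a a] f_0 by (metis mult_2 mult_eq_0_iff zero_neq_numeral)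

section \<open>The functional equation for \<open>g = 0\<close>\<close>

context
  fixes d :: 'a and \<psi> :: "'a \<Rightarrow> 'f"
  assumes rel: "\<And>a b. 2 * f a b * \<psi> (a + b) = f (a + d) b * \<psi> a + f a (b + d) * \<psi> b"
begin

text \<open>In the relation for \<open>a\<close> and \<open>a + a\<close> the left side vanishes,
  and the right side is \<open>f a d * (\<psi> (a + a) - 2 * \<psi> a)\<close>.\<close>

lemma psi_double:
  assumes "f a d \<noteq> 0"
  shows "\<psi> (a + a) = 2 * \<psi> a"
  using rel[of a "a + a"] assms anti[of d a] by (simp add: f_add f_self)

lemma psi_eq_0_if_f_nonzero:
  assumes "f a d \<noteq> 0"
  shows "\<psi> a = 0"
proof -
  \<comment> \<open>This choice makes the coefficient \<open>f (a + d) b\<close> vanish, while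
    \<open>a\<close>, \<open>b\<close> and \<open>a + b\<close> all pair nontrivially with
    \<open>d\<close>, so that \<open>psi_double\<close> applies to them.\<close>
  define b where "b = a + d"
  have nz: "f b d = f a d" "f (a + b) d = 2 * f a d" "f a b = f a d" "f d b = - f a d" "f b a = - f a d" 
    using anti[of d a] by (simp_all add: b_def f_add f_self)
  have db: "\<psi> (b + b) = 2 * \<psi> b" "\<psi> (a + b + (a + b)) = 2 * \<psi> (a + b)" "\<psi> (a + a) = 2 * \<psi> a"
    using nz assms by (auto intro!: psi_double)
  have e: "a + a + (b + b) = a + b + (a + b)" by (simp add: ac_simps)
  \<comment> \<open>\<open>r1\<close> and \<open>r2\<close> give
    \<open>\<psi> a = \<psi> b = \<psi> (a + b)\<close>. Then \<open>r3\<close> and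
    \<open>r4\<close> yield the two values \<open>\<psi> a / 2\<close> and
    \<open>3 * \<psi> a / 2\<close> for \<open>\<psi> (a + a + b)\<close>.\<close>
  have r1: "2 * f a d * \<psi> (a + b) = 2 * f a d * \<psi> b"
    using rel[of a b] nz by (simp add: f_add algebra_simps)
  have r2: "16 * f a d * \<psi> (a + b) = 4 * f a d * \<psi> a + 12 * f a d * \<psi> b"
    using rel[of "a + a" "b + b"] nz db e by (simp add: f_add algebra_simps)
  have r3: "2 * f a d * \<psi> (a + a + b) = 2 * f a d * \<psi> (a + b) - f a d * \<psi> a"
    using rel[of a "a + b"] nz anti[of d a] by (simp add: f_add f_self algebra_simps)
  have r4: "4 * f a d * \<psi> (a + a + b) = 2 * f a d * \<psi> a + 4 * f a d * \<psi> b"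
    using rel[of "a + a" b] nz db anti[of d a] by (simp add: f_add f_self algebra_simps)
  show ?thesis using r1 r2 r3 r4 assms by simp
qed

lemma psi_eq_0:
  assumes "d \<noteq> 0"
  shows "\<psi> a = 0"
proof (cases "f a d = 0")
  case True
  show ?thesis
  proof (cases "a = 0")
    case True
    then show ?thesis
      using rel[of 0] ex_f_nonzero[OF assms] by (auto simp: f_0)
  next
    case False
    \<comment> \<open>Both \<open>b\<close> and \<open>a - b\<close> pair nontrivially with
      \<open>d\<close>, since \<open>f (a - b) d = - f b d\<close>. So \<psi> vanishes at both, and
      their relation isolates \<psi> at the sum \<open>a\<close>.\<close>
    then obtain b where b: "f a b \<noteq> 0" "f d b \<noteq> 0" using assms ex_f_nonzero2 by blast
    have "\<psi> b = 0" "\<psi> (a - b) = 0"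
      using b anti[of b d] True by (auto intro!: psi_eq_0_if_f_nonzero simp: f_diff)
    then show ?thesis
      using rel[of b "a - b"] b anti[of b a] by (simp add: f_diff f_self)
  qed
qed (rule psi_eq_0_if_f_nonzero)

lemma psi_const_if_f_nonzero:
  assumes d: "d = 0" and ab: "f a b \<noteq> 0"
  shows "\<psi> a = \<psi> b"
proof -
  have avg: "2 * \<psi> (x + y) = \<psi> x + \<psi> y" if "f x y \<noteq> 0" for x y
    using rel[of x y] that by (simp add: d) algebra
  \<comment> \<open>These averages evaluate \<psi> at \<open>a + a + a + b\<close> in two ways, as
    \<open>\<psi> a\<close> and as \<open>(7 * \<psi> a + \<psi> b) / 8\<close>.\<close>
  have "2 * \<psi> (a + b) = \<psi> a + \<psi> b" "2 * \<psi> (a + (a + b)) = \<psi> a + \<psi> (a + b)"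
    "2 * \<psi> (a + a + b) = \<psi> (a + a) + \<psi> b" "2 * \<psi> (a + a + (a + b)) = \<psi> (a + a) + \<psi> (a + b)"
    "2 * \<psi> (a + (a + (a + b))) = \<psi> a + \<psi> (a + (a + b))"
    using ab by (auto intro!: avg simp: f_add f_self)
  then show ?thesis by (simp add: add.assoc) algebra
qed

text \<open>Some \<open>c\<close> pairs nontrivially with both \<open>a\<close> and \<open>b\<close>
  and links them. The index 0 pairs with nothing, so \<open>\<psi> 0\<close> stays free; this leaves
  room for the product of \<open>u 0\<close> with itself.\<close>

lemma psi_const:
  assumes "d = 0" "a \<noteq> 0" "b \<noteq> 0"
  shows "\<psi> a = \<psi> b"
  using assms ex_f_nonzero2 psi_const_if_f_nonzero by metis

end

section \<open>Half-derivations and products on \<open>L(A, 0, f)\<close>\<close>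

abbreviation "br \<equiv> block_bracket (\<lambda>_. 0) f"

lemma half_derivation_shape:
  assumes "half_derivation fscale br \<phi>"
  shows "d \<noteq> 0 \<Longrightarrow> Poly_Mapping.lookup (\<phi> (u a)) (a + d) = 0"
    and "a \<noteq> 0 \<Longrightarrow> b \<noteq> 0 \<Longrightarrow> Poly_Mapping.lookup (\<phi> (u a)) a = Poly_Mapping.lookup (\<phi> (u b)) b"
proof -
  let ?\<psi> = "\<lambda>d a. Poly_Mapping.lookup (\<phi> (u a)) (a + d)"
  have rel: "2 * f a b * ?\<psi> d (a + b) = f (a + d) b * ?\<psi> d a + f a (b + d) * ?\<psi> d b" for a b d
    using half_derivation_coeff[OF assms, of a b d] by (simp only: add_0_right)
  show "?\<psi> d a = 0" if "d \<noteq> 0"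
    by (rule psi_eq_0[where d = d and \<psi> = "?\<psi> d", OF rel that])
  show "Poly_Mapping.lookup (\<phi> (u a)) a = Poly_Mapping.lookup (\<phi> (u b)) b" if "a \<noteq> 0" "b \<noteq> 0"
    using psi_const[where d = 0 and \<psi> = "?\<psi> 0", OF rel refl that] by (simp only: add_0_right)
qed

lemma half_derivation_diagonal:
  assumes "half_derivation fscale br \<phi>"
  shows "\<phi> (u a) = fscale (Poly_Mapping.lookup (\<phi> (u a)) a) (u a)"
proof (rule poly_mapping_eqI)
  fix e
  show "Poly_Mapping.lookup (\<phi> (u a)) e = Poly_Mapping.lookup (fscale (Poly_Mapping.lookup (\<phi> (u a)) a) (u a)) e"
    using half_derivation_shape(1)[OF assms, of "e - a" a] by (simp add: lookup_u)
qed

text \<open>For \<open>a \<noteq> b\<close> the product is a multiple of \<open>u b\<close> and, by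
  commutativity, of \<open>u a\<close>, hence 0. For \<open>a = b \<noteq> 0\<close> the diagonal
  coefficient of \<open>m (u a)\<close> at \<open>a\<close> equals the one at \<open>a + a\<close>,
  which is 0 by the first case.\<close>

lemma transposed_poisson_basis:
  assumes m: "transposed_poisson fscale br m" and nontrivial: "\<exists>a::'a. a \<noteq> 0"
  shows "m (u a) (u b) = (if a = 0 \<and> b = 0 then fscale (Poly_Mapping.lookup (m (u 0) (u 0)) 0) (u 0) else 0)"
proof -
  note hd = transposed_poisson_half_derivation[OF m]
  note diag = half_derivation_diagonal[OF hd]
  note const = half_derivation_shape(2)[OF hd]
  have comm: "m x y = m y x" for x y
    using m by (simp add: transposed_poisson_def comm_assoc_product_def)
  have eq0: "m (u a) (u b) = 0" if "a \<noteq> b" for a b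
  proof -
    have "fscale (Poly_Mapping.lookup (m (u a) (u b)) b) (u b) = fscale (Poly_Mapping.lookup (m (u b) (u a)) a) (u a)"
      using diag[of "u a" b] diag[of "u b" a] comm by simp
    from arg_cong[OF this, of "\<lambda>x. Poly_Mapping.lookup x b"]
    have "Poly_Mapping.lookup (m (u a) (u b)) b = 0" using that by (simp add: lookup_u)
    then show ?thesis using diag[of "u a" b] by (simp add: fscale_0)
  qed
  have "m (u a) (u a) = 0" if "a \<noteq> 0" for a
  proof -
    have "Poly_Mapping.lookup (m (u a) (u a)) a = Poly_Mapping.lookup (m (u a) (u (a + a))) (a + a)"
      using that double_nonzero by (intro const) auto
    also have "\<dots> = 0" using that eq0[of a "a + a"] by simp
    finally show ?thesis using diag[of "u a" a] by (simp add: fscale_0)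
  qed
  then show ?thesis using eq0 diag[of "u 0" 0] by (cases "a = b") auto
qed

definition unit_product :: "('a \<Rightarrow>\<^sub>0 'f) \<Rightarrow> ('a \<Rightarrow>\<^sub>0 'f) \<Rightarrow> ('a \<Rightarrow>\<^sub>0 'f)"
  where "unit_product x y = fscale (Poly_Mapping.lookup x 0 * Poly_Mapping.lookup y 0) (u 0)"

lemma unit_product_u: "unit_product (u a) (u b) = (if a = 0 \<and> b = 0 then u 0 else 0)"
  by (rule poly_mapping_eqI) (auto simp: unit_product_def lookup_u)

lemma unit_product_nontrivial: "\<not> trivial_product unit_product"
  by (metis unit_product_u[of 0 0] trivial_product_def u_nonzero)

lemma bilinear_unit_product: "bilinear_product fscale unit_product"
  unfolding bilinear_fscale_iff unit_product_def
  by (auto intro!: poly_mapping_eqI simp: lookup_add lookup_u algebra_simps)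

text \<open>Index 0 arises only from pairs \<open>- k\<close>, \<open>k\<close>, for which f
  vanishes. With \<open>br_u_0\<close> this makes all terms of the transposed identity for
  \<open>unit_product\<close> zero.\<close>

lemma lookup_br_0: "Poly_Mapping.lookup (br x y) 0 = 0"
proof (induction y rule: block_induct)
  case (basis k v)
  then show ?case by (simp add: block_bracket_fscale lookup_block_bracket_u_right f_minus f_self)
qed (simp add: block_bracket_add lookup_add)

lemma br_u_0: "br x (u 0) = 0" "br (u 0) x = 0"
  by (rule poly_mapping_eqI; simp add: lookup_block_bracket_u_right lookup_block_bracket_u_left f_0)+

lemma transposed_poisson_unit_product: "transposed_poisson fscale br unit_product"
  unfolding transposed_poisson_def comm_assoc_product_def
proof (intro conjI allI)
  show "bilinear_product fscale unit_product" by (rule bilinear_unit_product)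
  fix x y z
  show "unit_product x y = unit_product y x"
    "unit_product (unit_product x y) z = unit_product x (unit_product y z)"
    by (simp_all add: unit_product_def lookup_u mult_ac)
  show "fscale 2 (unit_product z (br x y)) = br (unit_product z x) y + br x (unit_product z y)"
    by (simp add: unit_product_def lookup_br_0 block_bracket_fscale br_u_0 fscale_0)
qed

lemma transposed_poisson_multiple:
  assumes "transposed_poisson fscale br m" "\<exists>a::'a. a \<noteq> 0"
  shows "\<exists>c. m = (\<lambda>x y. fscale c (unit_product x y))"
proof -
  let ?c = "Poly_Mapping.lookup (m (u 0) (u 0)) 0"
  have "m x y = fscale ?c (unit_product x y)" for x y
  proof (rule bilinear_product_eqI[where m' = "\<lambda>x y. fscale ?c (unit_product x y)"])
    show "bilinear_product fscale m"
      using assms by (simp add: transposed_poisson_def comm_assoc_product_def)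
    show "bilinear_product fscale (\<lambda>x y. fscale ?c (unit_product x y))"
      using bilinear_unit_product unfolding bilinear_fscale_iff
      by (auto intro!: poly_mapping_eqI simp: lookup_add algebra_simps)
    show "m (u a) (u b) = fscale ?c (unit_product (u a) (u b))" for a b
      using transposed_poisson_basis[OF assms, of a b] by (simp add: unit_product_u fscale_0)
  qed
  then show ?thesis by blast
qed

text \<open>Rescaling the central element \<open>u 0\<close>, which no bracket involves, is an automorphism.\<close>

lemma isomorphic_multiple:
  assumes "c \<noteq> 0"
  shows "isomorphic_structures fscale br (\<lambda>x y. fscale c (unit_product x y)) unit_product"
proof -
  define \<phi> where "\<phi> k x = x + fscale ((k - 1) * Poly_Mapping.lookup x 0) (u 0)" for k and x :: "'a \<Rightarrow>\<^sub>0 'f"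
  have \<phi>: "Poly_Mapping.lookup (\<phi> k x) e = (if e = 0 then k else 1) * Poly_Mapping.lookup x e" for k x e
    by (simp add: \<phi>_def lookup_add lookup_u algebra_simps)
  have "bij (\<phi> c)"
  proof (rule o_bij)
    show "\<phi> (inverse c) \<circ> \<phi> c = id" "\<phi> c \<circ> \<phi> (inverse c) = id"
      using assms by (auto intro!: ext poly_mapping_eqI simp: \<phi>)
  qed
  moreover have "Vector_Spaces.linear fscale fscale (\<phi> c)"
    using vector_space_fscale
    by (auto simp: Vector_Spaces.linear_iff lookup_add \<phi> algebra_simps intro!: poly_mapping_eqI)
  moreover have "\<phi> c (br x y) = br (\<phi> c x) (\<phi> c y)" for x y
    by (simp add: \<phi>_def block_bracket_add block_bracket_fscale br_u_0 lookup_br_0 fscale_0)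
  \<comment> \<open>Both sides carry the factor \<open>c * c\<close>: once from the scalar and the
    map, once from the two arguments.\<close>
  moreover have "\<phi> c (fscale c (unit_product x y)) = unit_product (\<phi> c x) (\<phi> c y)" for x y
    by (rule poly_mapping_eqI) (auto simp: \<phi> unit_product_def lookup_u)
  ultimately show ?thesis unfolding isomorphic_structures_def by blast
qed

end
section \<open>The case \<open>g \<noteq> 0\<close>\<close>

text \<open>\<open>independent\<close> is the non-degeneracy of
  \<open>f a b = g a * h b - g b * h a\<close>. It makes \<open>(g, h)\<close> injective, so the
  group is embedded in the plane over the field.\<close>

locale planar_group =
  fixes g h :: "'a::ab_group_add \<Rightarrow> 'f::field_char_0"
  assumes additive_g: "additive g" and additive_h: "additive h" and g_nonzero: "\<exists>a. g a \<noteq> 0"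
    and independent: "a \<noteq> 0 \<Longrightarrow> \<exists>b. g a * h b \<noteq> g b * h a"
begin

lemma g_add: "g (a + b) = g a + g b" and h_add: "h (a + b) = h a + h b"
  and g_minus: "g (- a) = - g a" and h_minus: "h (- a) = - h a"
  and g_diff: "g (a - b) = g a - g b" and h_diff: "h (a - b) = h a - h b"
  and g_0: "g 0 = 0" and h_0: "h 0 = 0"
  using additive_g additive_h by (auto simp: additive.add additive.minus additive.diff additive.zero)

lemmas gh_simps = g_add h_add g_minus h_minus g_diff h_diff g_0 h_0

lemma eq_0_if: "g a = 0 \<Longrightarrow> h a = 0 \<Longrightarrow> a = 0"
  using independent[of a] by auto

text \<open>The structure constant \<open>f a b + g (a - b)\<close>, rewritten as the determinant of
  the shifted points \<open>(g a, h a + 1)\<close> and \<open>(g b, h b + 1)\<close>. The shift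
  moves \<open>(0, -1)\<close> to the origin.\<close>

definition \<omega> :: "'a \<Rightarrow> 'a \<Rightarrow> 'f"
  where "\<omega> a b = g a * (h b + 1) - g b * (h a + 1)"

section \<open>The functional equation for \<open>g \<noteq> 0\<close>\<close>

context
  fixes d :: 'a and \<psi> :: "'a \<Rightarrow> 'f"
  assumes rel: "\<And>a b. 2 * \<omega> a b * \<psi> (a + b) = \<omega> (a + d) b * \<psi> a + \<omega> a (b + d) * \<psi> b"
begin

text \<open>This is the relation for 0 and \<open>b\<close>, where
  \<open>\<omega> 0 b = - g b\<close>. It determines \<psi> by \<open>\<psi> 0\<close> off the line
  \<open>g b = g d\<close>.\<close>

lemma psi_by_psi_0: "(g d - g b) * \<psi> b = (g d * (h b + 1) - g b * (h d + 1)) * \<psi> 0"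
  using rel[of 0 b] by (simp add: \<omega>_def gh_simps algebra_simps)

text \<open>
  With \<open>y = g d * (h b + 1) - g b * h d\<close>, which does not change when a multiple of \<open>d\<close> is added
  to \<open>b\<close>, the relation for \<open>k d\<close> and \<open>b\<close> reduces to
  \<open>k (y (g d - g b) + k y g d - 2 g d g b) (y - g d) \<psi> 0 = 0\<close>; the values \<open>k = -1\<close> and \<open>k = 2\<close>
  force \<open>\<psi> 0 = 0\<close> when \<open>y\<close> is neither \<open>0\<close> nor \<open>g d\<close>.
\<close>

lemma psi_0_eq_0_if:
  assumes gd: "g d \<noteq> 0" and y: "y = g d * (h b + 1) - g b * h d" "y \<noteq> 0" "y \<noteq> g d"
  shows "\<psi> 0 = 0"
proof (rule ccontr)
  let ?x = "g b" and ?\<delta> = "g d" and ?\<kappa> = "\<psi> 0"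
  assume nz: "?\<kappa> \<noteq> 0"
  \<comment> \<open>At \<open>b = k d\<close> both coefficients in \<open>psi_by_psi_0\<close> equal
    \<open>(1 - k) * g d\<close>, so \<psi> takes the value \<open>\<psi> 0\<close> there for
    \<open>k \<noteq> 1\<close>.\<close>
  have k1: "\<psi> (- d) = ?\<kappa>"
    using psi_by_psi_0[of "- d"] gd by (simp add: gh_simps) algebra
  have k2: "\<psi> (d + d) = ?\<kappa>"
    using psi_by_psi_0[of "d + d"] gd by (simp add: gh_simps) algebra
  have E0: "(?\<delta> - ?x) * \<psi> b = (y - ?x) * ?\<kappa>"
    using psi_by_psi_0[of b] unfolding y(1) by (simp add: algebra_simps)
  have E1: "(?\<delta> + ?\<delta> - ?x) * \<psi> (- d + b) = (y + ?\<delta> - ?x) * ?\<kappa>"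
    using psi_by_psi_0[of "- d + b"] unfolding y(1) by (simp add: gh_simps algebra_simps)
  have E2: "(- ?\<delta> - ?x) * \<psi> (d + d + b) = (y - 2 * ?\<delta> - ?x) * ?\<kappa>"
    using psi_by_psi_0[of "d + d + b"] unfolding y(1) by (simp add: gh_simps algebra_simps)
  have R1: "2 * (- y - ?x) * \<psi> (- d + b) = - ?x * ?\<kappa> + (- y - ?x - ?\<delta>) * \<psi> b"
    using rel[of "- d" b] k1 unfolding y(1) by (simp add: \<omega>_def gh_simps algebra_simps)
  have R2: "2 * (2 * y - ?x) * \<psi> (d + d + b) = (3 * y - ?x) * ?\<kappa> + (2 * y - ?x - ?\<delta>) * \<psi> b"
    using rel[of "d + d" b] k2 unfolding y(1) by (simp add: \<omega>_def gh_simps algebra_simps)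
  have "(y * (?\<delta> - ?x) - y * ?\<delta> - 2 * ?x * ?\<delta>) * (y - ?\<delta>) * ?\<kappa> = 0"
    using E0 E1 R1 by algebra
  moreover have "2 * (y * (?\<delta> - ?x) + 2 * y * ?\<delta> - 2 * ?x * ?\<delta>) * (y - ?\<delta>) * ?\<kappa> = 0"
    using E0 E2 R2 by algebra
  \<comment> \<open>The first factors of the two products, apart from the constant 2, differ by this
    term.\<close>
  ultimately have "3 * y * ?\<delta> = 0" using nz y(3) by simp algebra
  then show False using gd y(2) by simp
qed

lemma psi_eq_0_if_g_nonzero:
  assumes gd: "g d \<noteq> 0"
  shows "\<psi> b = 0"
proof -
  have "d \<noteq> 0" using gd g_0 by auto
  then obtain c where c: "g d * h c \<noteq> g c * h d" using independent by blast
  \<comment> \<open>At \<open>c\<close> the quantity \<open>y\<close> is \<open>g d\<close> plus a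
    nonzero determinant, hence not \<open>g d\<close>. Should it be 0, its value at
    \<open>- c\<close> is \<open>2 * g d\<close>.\<close>
  have \<psi>0: "\<psi> 0 = 0"
  proof (cases "g d * (h c + 1) - g c * h d = 0")
    case True
    show ?thesis
    proof (rule psi_0_eq_0_if[OF gd refl, of "- c"])
      have "g d * (h (- c) + 1) - g (- c) * h d = 2 * g d"
        using True by (simp add: gh_simps algebra_simps)
      then show "g d * (h (- c) + 1) - g (- c) * h d \<noteq> 0" "g d * (h (- c) + 1) - g (- c) * h d \<noteq> g d"
        using gd by simp_all
    qed
  next
    case False
    then show ?thesis
      by (rule psi_0_eq_0_if[OF gd refl]) (use c in \<open>simp add: algebra_simps\<close>)
  qed
  have off: "\<psi> b = 0" if "g b \<noteq> g d" for b
    using psi_by_psi_0[of b] that \<psi>0 by simp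
  show ?thesis
  proof (cases "g b = g d")
    case True
    \<comment> \<open>A point on the line \<open>g b = g d\<close> is the sum of \<open>- b\<close>
      and \<open>b + b\<close>, which both lie off this line.\<close>
    have "\<psi> (- b) = 0" "\<psi> (b + b) = 0"
      using True gd by (auto intro!: off simp: gh_simps eq_neg_iff_add_eq_0)
    moreover have "\<omega> (- b) (b + b) = - 3 * g b"
      by (simp add: \<omega>_def gh_simps algebra_simps)
    ultimately show ?thesis using rel[of "- b" "b + b"] True gd by simp
  qed (rule off)
qed

text \<open>Once \<psi> vanishes where \<open>g \<noteq> 0\<close>, a point \<open>b\<close> with
  \<open>g b = 0\<close> is written as the sum of \<open>a\<close> and \<open>b - a\<close>; the
  coefficient of \<open>\<psi> b\<close> is then a multiple of \<open>h b + 2\<close>. If this is 0,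
  \<open>b\<close> is used as a summand instead, and only \<open>h d = 1\<close> survives.\<close>

lemma psi_eq_0_if_g_eq_0:
  assumes d: "g d = 0" "d \<noteq> 0" and b: "\<not> (g b = 0 \<and> h b = - 2 \<and> h d = 1)"
  shows "\<psi> b = 0"
proof -
  obtain a where ga: "g a \<noteq> 0" using g_nonzero by blast
  have hd: "h d \<noteq> 0" using d eq_0_if by blast
  have on: "\<psi> x = (h d + 1) * \<psi> 0" if "g x \<noteq> 0" for x
    using psi_by_psi_0[of x] that d by simp
  have "g (a + a) \<noteq> 0" "g (a + (a + a)) \<noteq> 0" using ga by (simp_all add: g_add)
  then have "\<psi> a = (h d + 1) * \<psi> 0" "\<psi> (a + a) = (h d + 1) * \<psi> 0" "\<psi> (a + (a + a)) = (h d + 1) * \<psi> 0"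
    using ga by (intro on; simp)+
  \<comment> \<open>All three values of \<psi> in the relation for \<open>a\<close> and
    \<open>a + a\<close> agree, but its coefficients fail to balance by
    \<open>g a * h d\<close>.\<close>
  then have "g a * h d * ((h d + 1) * \<psi> 0) = 0"
    using rel[of a "a + a"] d(1) unfolding \<omega>_def gh_simps by algebra
  then have off: "\<psi> x = 0" if "g x \<noteq> 0" for x using on[OF that] ga hd by simp
  show ?thesis
  proof (cases "g b = 0 \<and> h b = - 2")
    case True
    have "\<psi> a = 0" "\<psi> (b + a) = 0" using True ga by (auto intro!: off simp: g_add)
    then have "g a * (h d - 1) * \<psi> b = 0"
      using rel[of b a] True d(1) unfolding \<omega>_def gh_simps by algebra
    then show ?thesis using b True ga by simp
  next
    case False
    have "2 * (g a * (h b + 2)) * \<psi> b = 0" if "g b = 0"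
    proof -
      have "\<psi> a = 0" "\<psi> (b - a) = 0" using that ga by (auto intro!: off simp: g_diff)
      then show ?thesis using rel[of a "b - a"] that
        by (simp add: \<omega>_def gh_simps algebra_simps)
    qed
    then show ?thesis using False ga off by (auto simp: add_eq_0_iff2)
  qed
qed

lemma psi_const:
  assumes d: "d = 0"
  shows "\<psi> b = \<psi> 0"
proof -
  obtain a where ga: "g a \<noteq> 0" using g_nonzero by blast
  have on: "\<psi> x = \<psi> 0" if "g x \<noteq> 0" for x
    using psi_by_psi_0[of x] that by (simp add: d gh_simps)
  show ?thesis
  proof (cases "g b = 0")
    case True
    have v: "\<psi> a = \<psi> 0" "\<psi> (b - a) = \<psi> 0" "\<psi> (b + a) = \<psi> 0"
      using True ga by (auto intro!: on simp: gh_simps)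
    \<comment> \<open>Using \<open>b\<close> as a sum gives the factor \<open>h b + 2\<close>, using
      it as a summand gives \<open>h b + 1\<close>; these cannot both be 0.\<close>
    have "\<omega> a (b - a) = g a * (h b + 2)"
      using True by (simp add: \<omega>_def gh_simps algebra_simps)
    then have "2 * (g a * (h b + 2)) * (\<psi> b - \<psi> 0) = 0"
      using rel[of a "b - a"] v d by simp
    moreover have "g a * (h b + 1) * (\<psi> b - \<psi> 0) = 0"
      using rel[of b a] v True d by (simp add: \<omega>_def gh_simps) auto
    ultimately have "g a * (\<psi> b - \<psi> 0) = 0" by algebra
    then show ?thesis using ga by simp
  qed (rule on)
qed

end

section \<open>Half-derivations and products for \<open>g \<noteq> 0\<close>\<close>

definition br :: "('a \<Rightarrow>\<^sub>0 'f) \<Rightarrow> ('a \<Rightarrow>\<^sub>0 'f) \<Rightarrow> ('a \<Rightarrow>\<^sub>0 'f)"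
  where "br = block_bracket g (\<lambda>a b. g a * h b - g b * h a)"

lemma br_u: "br (u a) (u b) = fscale (\<omega> a b) (u (a + b))"
  by (simp add: br_def block_bracket_basis \<omega>_def gh_simps algebra_simps)

lemma lookup_br_u: "Poly_Mapping.lookup (br x (u b)) e = Poly_Mapping.lookup x (e - b) * \<omega> (e - b) b"
  by (simp add: br_def lookup_block_bracket_u_right \<omega>_def gh_simps algebra_simps)

lemma bilinear_br: "bilinear_product fscale br"
  unfolding br_def by (rule bilinear_block_bracket)

lemma half_derivation_shape:
  assumes hd: "half_derivation fscale br \<phi>"
  shows "e \<noteq> b \<Longrightarrow> \<not> (g b = 0 \<and> h b = - 2 \<and> g e = 0 \<and> h e = - 1) \<Longrightarrow> Poly_Mapping.lookup (\<phi> (u b)) e = 0"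
    and "Poly_Mapping.lookup (\<phi> (u a)) a = Poly_Mapping.lookup (\<phi> (u b)) b"
proof -
  let ?\<psi> = "\<lambda>d a. Poly_Mapping.lookup (\<phi> (u a)) (a + d)"
  have rel: "2 * \<omega> a b * ?\<psi> d (a + b) = \<omega> (a + d) b * ?\<psi> d a + \<omega> a (b + d) * ?\<psi> d b" for a b d
    using half_derivation_coeff[OF hd[unfolded br_def], of a b d]
    by (simp add: \<omega>_def gh_simps algebra_simps)
  show "Poly_Mapping.lookup (\<phi> (u b)) e = 0"
    if e: "e \<noteq> b" "\<not> (g b = 0 \<and> h b = - 2 \<and> g e = 0 \<and> h e = - 1)"
  proof -
    have "?\<psi> (e - b) b = 0"
    proof (cases "g (e - b) = 0")
      case True
      \<comment> \<open>The exceptional shift of \<open>psi_eq_0_if_g_eq_0\<close>, starting at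
        \<open>(0, -2)\<close>, ends at \<open>(0, -1)\<close>.\<close>
      have "h e = - 1" if "h b = - 2" "h (e - b) = 1" using that unfolding h_diff by algebra
      then show ?thesis
        using e True
        by (intro psi_eq_0_if_g_eq_0[where d = "e - b" and \<psi> = "?\<psi> (e - b)", OF rel]) (auto simp: g_diff)
    next
      case False
      then show ?thesis
        by (rule psi_eq_0_if_g_nonzero[where d = "e - b" and \<psi> = "?\<psi> (e - b)", OF rel])
    qed
    then show ?thesis by simp
  qed
  have "?\<psi> 0 b = ?\<psi> 0 0" for b
    by (rule psi_const[where d = 0 and \<psi> = "?\<psi> 0", OF rel refl])
  then show "Poly_Mapping.lookup (\<phi> (u a)) a = Poly_Mapping.lookup (\<phi> (u b)) b"
    by (metis add_0_right)
qed

text \<open>All diagonal coefficients of \<open>m (u a)\<close> agree. The one at some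
  \<open>x \<noteq> a\<close> with \<open>g x \<noteq> 0\<close> is, by commutativity, an
  off-diagonal coefficient of \<open>m (u x)\<close>, hence 0. Only the exceptional coefficients
  remain.\<close>

lemma transposed_poisson_support:
  assumes m: "transposed_poisson fscale br m"
    and nz: "Poly_Mapping.lookup (m (u a) (u b)) e \<noteq> 0"
  shows "g b = 0 \<and> h b = - 2 \<and> g e = 0 \<and> h e = - 1"
proof (rule ccontr)
  assume *: "\<not> ?thesis"
  note shape = half_derivation_shape[OF transposed_poisson_half_derivation[OF m]]
  \<comment> \<open>Both \<open>c\<close> and \<open>c + c\<close> have nonzero g, and at most one
    of them is \<open>a\<close>.\<close>
  obtain c where "g c \<noteq> 0" using g_nonzero by blast
  moreover have "c + c \<noteq> c" using calculation g_0 by auto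
  ultimately obtain x where x: "g x \<noteq> 0" "x \<noteq> a" by (metis add_cancel_left_right g_add mult_2 mult_eq_0_iff zero_neq_numeral)
  have "Poly_Mapping.lookup (m (u x) (u a)) x = 0"
    using shape(1)[of x a] x by auto
  then have "Poly_Mapping.lookup (m (u a) (u x)) x = 0"
    using m by (simp add: transposed_poisson_def comm_assoc_product_def)
  then have "Poly_Mapping.lookup (m (u a) (u b)) b = 0"
    using shape(2) by metis
  then show False using shape(1)[of e b] * nz by auto
qed

lemma transposed_poisson_trivial:
  assumes m: "transposed_poisson fscale br m" and none: "\<And>a. \<not> (g a = 0 \<and> h a = - 1)"
  shows "trivial_product m"
proof -
  have "m x y = (\<lambda>_ _. 0) x y" for x y
  proof (rule bilinear_product_eqI[where m = m and m' = "\<lambda>_ _. 0"])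
    show "bilinear_product fscale m"
      using m by (simp add: transposed_poisson_def comm_assoc_product_def)
    show "bilinear_product fscale (\<lambda>_ _. 0 :: 'a \<Rightarrow>\<^sub>0 'f)"
      by (simp add: bilinear_fscale_iff fscale_0)
    show "m (u a) (u b) = 0" for a b
      using transposed_poisson_support[OF m] none by (intro poly_mapping_eqI) auto
  qed
  then show ?thesis by (simp add: trivial_product_def)
qed

section \<open>Center and derived algebra\<close>

lemma lie_center_br: "lie_center br = module.span fscale {u a |a. g a = 0 \<and> h a + 1 = 0}"
  unfolding span_u
proof (intro equalityI subsetI CollectI allI impI)
  fix z a assume z: "z \<in> lie_center br" "Poly_Mapping.lookup z a \<noteq> 0"
  have \<omega>: "\<omega> a b = 0" for b
    using lookup_br_u[of z b "a + b"] z by (simp add: lie_center_def)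
  \<comment> \<open>Testing against \<open>u 0\<close> gives \<open>g a = 0\<close>; testing against
    \<open>u c\<close> then gives \<open>g c * (h a + 1) = 0\<close>.\<close>
  obtain c where "g c \<noteq> 0" using g_nonzero by blast
  then show "g a = 0 \<and> h a + 1 = 0" using \<omega>[of 0] \<omega>[of c] by (simp add: \<omega>_def gh_simps)
next
  fix z :: "'a \<Rightarrow>\<^sub>0 'f" assume z: "z \<in> {x. \<forall>a. Poly_Mapping.lookup x a \<noteq> 0 \<longrightarrow> g a = 0 \<and> h a + 1 = 0}"
  have "br z x = 0" for x
  proof (induction x rule: block_induct)
    case (basis k v)
    have "br z (u k) = 0"
    proof (rule poly_mapping_eqI)
      fix e
      show "Poly_Mapping.lookup (br z (u k)) e = Poly_Mapping.lookup 0 e"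
        using z by (cases "Poly_Mapping.lookup z (e - k) = 0") (auto simp: lookup_br_u \<omega>_def)
    qed
    then show ?case using bilinear_br by (simp add: bilinear_fscale_iff fscale_0)
  qed (use bilinear_br in \<open>simp add: bilinear_fscale_iff\<close>)
  then show "z \<in> lie_center br" by (simp add: lie_center_def)
qed

text \<open>If two indices add up to \<open>(0, -2)\<close>, their shifted points are opposite, so
  their determinant \<omega> is 0.\<close>

lemma lookup_br_eq_0:
  assumes "g e = 0" "h e = - 2"
  shows "Poly_Mapping.lookup (br x y) e = 0"
proof (induction y rule: block_induct)
  case (basis k v)
  have "\<omega> (e - k) k = 0" using assms by (simp add: \<omega>_def gh_simps algebra_simps)
  then show ?case using bilinear_br by (simp add: bilinear_fscale_iff lookup_br_u)
qed (use bilinear_br in \<open>simp add: bilinear_fscale_iff lookup_add\<close>)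

lemma lie_derived_br: "lie_derived fscale br = module.span fscale {u a |a. \<not> (g a = 0 \<and> h a + 2 = 0)}"
proof -
  interpret V: vector_space "fscale :: 'f \<Rightarrow> ('a \<Rightarrow>\<^sub>0 'f) \<Rightarrow> _" by (rule vector_space_fscale)
  let ?D = "V.span {u a |a. \<not> (g a = 0 \<and> h a + 2 = 0)}"
  have "br x y \<in> ?D" for x y
    using lookup_br_eq_0[of _ x y] by (auto simp: span_u add_eq_0_iff2)
  then have "V.span {br x y |x y. True} \<subseteq> ?D" by (intro V.span_minimal) auto
  moreover have "u e \<in> V.span {br x y |x y. True}" if e: "\<not> (g e = 0 \<and> h e + 2 = 0)" for e
  proof -
    \<comment> \<open>Since \<open>\<omega> 0 e = - g e\<close>, the index 0 works if
      \<open>g e \<noteq> 0\<close>. Otherwise \<open>\<omega> c (e - c) = g c * (h e + 2)\<close>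
      is nonzero.\<close>
    obtain c where "g c \<noteq> 0" using g_nonzero by blast
    then have "\<omega> c (e - c) \<noteq> 0 \<or> \<omega> 0 e \<noteq> 0"
      using e by (simp add: \<omega>_def gh_simps) algebra
    then obtain a where a: "\<omega> a (e - a) \<noteq> 0" by (metis diff_zero)
    have "fscale (inverse (\<omega> a (e - a))) (br (u a) (u (e - a))) = u e"
      using a by (intro poly_mapping_eqI) (simp add: br_u)
    moreover have "fscale (inverse (\<omega> a (e - a))) (br (u a) (u (e - a))) \<in> V.span {br x y |x y. True}"
      by (intro V.span_scale V.span_base) blast
    ultimately show ?thesis by simp
  qed
  then have "?D \<subseteq> V.span {br x y |x y. True}" by (intro V.span_minimal) auto
  ultimately show ?thesis by (auto simp: lie_derived_def)
qed

section \<open>Products as extensions by zero\<close>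

lemma transposed_poisson_in_center:
  assumes m: "transposed_poisson fscale br m"
  shows "m x y \<in> lie_center br"
proof -
  interpret V: vector_space "fscale :: 'f \<Rightarrow> ('a \<Rightarrow>\<^sub>0 'f) \<Rightarrow> _" by (rule vector_space_fscale)
  have b: "bilinear_product fscale m"
    using m by (simp add: transposed_poisson_def comm_assoc_product_def)
  have sub: "V.subspace (lie_center br)" by (simp add: lie_center_br)
  show ?thesis
  proof (induction x rule: block_induct)
    case (basis k v)
    show ?case
    proof (induction y rule: block_induct)
      case (basis l w)
      have "m (u k) (u l) \<in> lie_center br"
        unfolding lie_center_br span_u using transposed_poisson_support[OF m] by auto
      then show ?case
        using b sub by (simp add: bilinear_fscale_iff V.subspace_scale)
    qed (use b sub in \<open>simp add: bilinear_fscale_iff V.subspace_add\<close>)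
  qed (use b sub in \<open>simp add: bilinear_fscale_iff V.subspace_add\<close>)
qed

lemma transposed_poisson_derived:
  assumes m: "transposed_poisson fscale br m" and y: "y \<in> lie_derived fscale br"
  shows "m x y = 0"
proof -
  interpret V: vector_space "fscale :: 'f \<Rightarrow> ('a \<Rightarrow>\<^sub>0 'f) \<Rightarrow> _" by (rule vector_space_fscale)
  have b: "bilinear_product fscale m"
    using m by (simp add: transposed_poisson_def comm_assoc_product_def)
  show ?thesis
  proof (induction x rule: block_induct)
    case (basis k v)
    have "V.subspace {y. m (u k) y = 0}"
      using b by (auto simp: V.subspace_def bilinear_fscale_iff fscale_0) (metis add_cancel_left_left)
    moreover have "m (u k) (u a) = 0" if "\<not> (g a = 0 \<and> h a + 2 = 0)" for a
    proof (rule poly_mapping_eqI)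
      show "Poly_Mapping.lookup (m (u k) (u a)) e = Poly_Mapping.lookup 0 e" for e
        using transposed_poisson_support[OF m, of k a e] that by force
    qed
    ultimately have "lie_derived fscale br \<subseteq> {y. m (u k) y = 0}"
      unfolding lie_derived_br by (intro V.span_minimal) auto
    then show ?case using y b by (auto simp: bilinear_fscale_iff fscale_0)
  qed (use b in \<open>simp add: bilinear_fscale_iff\<close>)
qed

lemma is_complement_derived:
  "is_complement fscale (module.span fscale {u a |a. g a = 0 \<and> h a + 2 = 0}) (lie_derived fscale br)"
  unfolding lie_derived_br by (rule is_complement_span_u)

lemma lie_algebra_br: "lie_algebra fscale br"
  unfolding br_def
proof (rule block_lie_algebra[where h = h])
  show "biadditive (\<lambda>a b. g a * h b - g b * h a)"
    by (auto simp: biadditive_def additive_def gh_simps algebra_simps)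
qed (use additive_g additive_h in \<open>auto simp: algebra_simps\<close>)

text \<open>For the forward direction \<open>m\<close> is its own witness, having central values and
  vanishing on \<open>D\<close>. The converse is the general fact about extensions by zero.\<close>

lemma transposed_poisson_iff:
  fixes m
  defines "V \<equiv> module.span fscale {u a |a. g a = 0 \<and> h a + 2 = 0}"
  defines "D \<equiv> lie_derived fscale br"
  shows "transposed_poisson fscale br m \<longleftrightarrow>
    (\<exists>s. comm_product_into fscale V (lie_center br) s \<and> associative_by_zero V D s \<and> m = extension_by_zero V D s)"
proof -
  interpret V: vector_space "fscale :: 'f \<Rightarrow> ('a \<Rightarrow>\<^sub>0 'f) \<Rightarrow> _" by (rule vector_space_fscale)
  note compl = is_complement_derived[folded V_def]
  show ?thesis
  proof
    assume m: "transposed_poisson fscale br m"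
    then have "comm_assoc_product fscale m" by (simp add: transposed_poisson_def)
    note V.eq_extension_by_zero[OF compl this transposed_poisson_in_center[OF m] transposed_poisson_derived[OF m]]
    then show "\<exists>s. comm_product_into fscale V (lie_center br) s \<and> associative_by_zero V D s \<and> m = extension_by_zero V D s"
      unfolding D_def by blast
  qed (use V.extension_by_zero_poisson(1)[OF compl lie_algebra_br] in \<open>auto simp: D_def\<close>)
qed

lemma transposed_poisson_imp_poisson:
  assumes "transposed_poisson fscale br m"
  shows "poisson fscale br m"
proof -
  interpret V: vector_space "fscale :: 'f \<Rightarrow> ('a \<Rightarrow>\<^sub>0 'f) \<Rightarrow> _" by (rule vector_space_fscale)
  show ?thesis
    using assms V.extension_by_zero_poisson(2)[OF is_complement_derived lie_algebra_br]
    unfolding transposed_poisson_iff by blast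
qed

end

theorem theoremB:
  fixes g h :: "'a::ab_group_add \<Rightarrow> 'f::field_char_0"
    and f :: "'a \<Rightarrow> 'a \<Rightarrow> 'f"
  assumes nontrivial: "\<exists>a::'a. a \<noteq> 0"
    and g: "additive g"
    and f: "biadditive f" "\<forall>a b. f a b = - f b a" "non_degenerate f"
    and gh: "g = (\<lambda>_. 0) \<or>
      (g \<noteq> (\<lambda>_. 0) \<and> additive h \<and> (\<forall>a b. f a b = g a * h b - g b * h a))"
  shows
    "(g = (\<lambda>_. 0) \<longrightarrow>
      (\<exists>m. transposed_poisson fscale (block_bracket g f) m \<and> \<not> trivial_product m \<and>
        (\<forall>a b. m (u a) (u b) = (if a = 0 \<and> b = 0 then u 0 else 0)) \<and>
        (\<forall>m'. transposed_poisson fscale (block_bracket g f) m' \<and> \<not> trivial_product m' \<longrightarrow>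
          isomorphic_structures fscale (block_bracket g f) m' m \<and>
          (\<exists>c. c \<noteq> 0 \<and> m' = (\<lambda>x y. fscale c (m x y)))))) \<and>
     (g \<noteq> (\<lambda>_. 0) \<and> (\<forall>a. (g a, h a) \<noteq> (0, -1)) \<longrightarrow>
      (\<forall>m. transposed_poisson fscale (block_bracket g f) m \<longrightarrow> trivial_product m)) \<and>
     (g \<noteq> (\<lambda>_. 0) \<and> (\<exists>a. (g a, h a) = (0, -1)) \<longrightarrow>
      (let br = block_bracket g f;
           V = module.span fscale {u a |a. g a = 0 \<and> h a + 2 = 0};
           D = lie_derived fscale br;
           Z = lie_center br
       in is_complement fscale V D \<and>
          Z = module.span fscale {u a |a. g a = 0 \<and> h a + 1 = 0} \<and>
          (\<forall>m. transposed_poisson fscale br m \<longleftrightarrow>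
            (\<exists>s. comm_product_into fscale V Z s \<and> associative_by_zero V D s \<and>
              m = extension_by_zero V D s)) \<and>
          (\<forall>m. transposed_poisson fscale br m \<longrightarrow> poisson fscale br m)))"
proof -
  have fab: "f a b = - f b a" for a b using f(2) by blast
  have "?thesis" if g0: "g = (\<lambda>_. 0)"
  proof -
    interpret symplectic_group f using f(1,3) fab by unfold_locales
    have *: "\<exists>c. c \<noteq> 0 \<and> m' = (\<lambda>x y. fscale c (unit_product x y))"
      if m': "transposed_poisson fscale br m'" "\<not> trivial_product m'" for m'
    proof -
      obtain c where c: "m' = (\<lambda>x y. fscale c (unit_product x y))"
        using transposed_poisson_multiple[OF m'(1) nontrivial] by blast
      then have "c \<noteq> 0" using m'(2) by (auto simp: trivial_product_def fscale_0)
      with c show ?thesis by blast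
    qed
    have "\<exists>m. transposed_poisson fscale br m \<and> \<not> trivial_product m \<and>
        (\<forall>a b. m (u a) (u b) = (if a = 0 \<and> b = 0 then u 0 else 0)) \<and>
        (\<forall>m'. transposed_poisson fscale br m' \<and> \<not> trivial_product m' \<longrightarrow>
          isomorphic_structures fscale br m' m \<and> (\<exists>c. c \<noteq> 0 \<and> m' = (\<lambda>x y. fscale c (m x y))))"
    proof (intro exI[of _ unit_product] conjI allI impI)
      fix m' assume "transposed_poisson fscale br m' \<and> \<not> trivial_product m'"
      then obtain c where "c \<noteq> 0" "m' = (\<lambda>x y. fscale c (unit_product x y))" using * by blast
      then show "isomorphic_structures fscale br m' unit_product"
        "\<exists>c. c \<noteq> 0 \<and> m' = (\<lambda>x y. fscale c (unit_product x y))"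
        using isomorphic_multiple by blast+
    qed (rule transposed_poisson_unit_product unit_product_nontrivial unit_product_u)+
    then show ?thesis unfolding g0 by simp
  qed
  moreover have "?thesis" if g0: "g \<noteq> (\<lambda>_. 0)"
  proof -
    have h: "additive h" and fgh: "f = (\<lambda>a b. g a * h b - g b * h a)" using gh g0 by auto
    interpret planar_group g h
    proof
      show "\<exists>b. g a * h b \<noteq> g b * h a" if "a \<noteq> 0" for a
        using f(3) that by (auto simp: non_degenerate_def fgh)
    qed (use g h g0 in \<open>auto simp: additive.add\<close>)
    have br: "block_bracket g f = br" by (simp add: br_def fgh)
    show ?thesis
      unfolding br Let_def
    proof (intro conjI impI allI)
      fix m assume *: "g \<noteq> (\<lambda>_. 0) \<and> (\<forall>a. (g a, h a) \<noteq> (0, - 1))" "transposed_poisson fscale br m"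
      then show "trivial_product m" by (intro transposed_poisson_trivial) auto
    next
      fix m assume "transposed_poisson fscale br m"
      then show "poisson fscale br m" by (rule transposed_poisson_imp_poisson)
    qed (use g0 in blast, rule is_complement_derived, rule lie_center_br, rule transposed_poisson_iff)
  qed
  ultimately show ?thesis by blast
qed

end
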